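(* Let $m,n\ge1$ and $d=m+n$. For any $A\in M_{m\times n}(\mathbb{R})$ and $\mathbf{v}_0\in(0,1)^d$ such that $Ap_2(\mathbf{v})\ne p_1(\mathbf{v}+\mathbf{v}_0)$ for all $\mathbf{v}\in\mathbb{Z}^d$, $$\beta(x_{A,\mathbf{v}_0})=\frac{n}{d}+\gamma(x_{A,\mathbf{v}_0})=1-\frac{1}{\mu(A,\mathbf{v}_0)}.$$
   Context: Write $\mathbb{R}^d=\mathbb{R}^m\times\mathbb{R}^n$ with projections $p_1,p_2$. Let $\|\mathbf{v}\|=\max(\|p_1(\mathbf{v})\|_2,\|p_2(\mathbf{v})\|_2)$, where $\|\cdot\|_2$ is the Euclidean norm (also used for matrices). Let $X=(SL(d,\mathbb{R})\ltimes\mathbb{R}^d)/(SL(d,\mathbb{Z})\ltimes\mathbb{Z}^d)$ be the space of affine unimodular lattices, where $(g;\mathbf{w})$ acts on $\mathbb{R}^d$ by $\mathbf{u}\mapsto g\mathbf{u}+\mathbf{w}$. To $x=(g;\mathbf{w})(SL(d,\mathbb{Z})\ltimes\mathbb{Z}^d)$ associate the affine lattice $\Lambda_x=g\mathbb{Z}^d+\mathbf{w}$. The group $SL(d,\mathbb{R})$ acts on $X$ by left multiplication, so $\Lambda_{hx}=h\Lambda_x$ for $h\in SL(d,\mathbb{R})$. Let $\alpha_1(x)=\sup_{\mathbf{v}\in\Lambda_x}1/\|\mathbf{v}\|$, $$g_t=\begin{pmatrix}e^{nt/d}I_m&0\\0&e^{-mt/d}I_n\end{pmatrix},\qquad h_B=\begin{pmatrix}I_m&0\\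 B&I_n\end{pmatrix}\ (B\in M_{n\times m}(\mathbb{R})),\qquad \mathcal{B}_s=\{h_B:\|B\|_2\le s\},$$ $$\beta(x)=\limsup_{s\to\infty}\frac{\sup_{h\in\mathcal{B}_s}\log\alpha_1(hx)}{\log s},\qquad \gamma(x)=\limsup_{t\to\infty}\frac{\log\alpha_1(g_tx)}{t}.$$ Let $$x_{A,\mathbf{v}_0}=\left(\begin{pmatrix}I_m&-A\\0&I_n\end{pmatrix};\mathbf{v}_0\right)(SL(d,\mathbb{Z})\ltimes\mathbb{Z}^d)\in X.$$ The Diophantine exponent $\mu(A,\mathbf{v}_0)\in\mathbb{R}\cup\{+\infty\}$ is the supremum of the set of $\nu>0$ such that there are infinitely many $\mathbf{v}\in\mathbb{Z}^d$ with $p_2(\mathbf{v})\ne0$ and $\|Ap_2(\mathbf{v})-p_1(\mathbf{v}+\mathbf{v}_0)\|_2\le\|p_2(\mathbf{v})\|_2^{-(\nu-1)}$ (with $1/\infty=0$). *)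

theory Defs
  imports "HOL-Analysis.Analysis" "HOL-Algebra.Left_Coset"
begin

text \<open>
  The space \<open>\<real>\<^sup>m \<times> \<real>\<^sup>n\<close> is \<open>real ^ ('m + 'n)\<close>, so that \<open>d = CARD('m) + CARD('n)\<close>, and an
  \<open>m \<times> n\<close> matrix has type \<open>real ^ 'n ^ 'm\<close>.
\<close>

definition p1 :: "real ^ ('m::finite + 'n::finite) \<Rightarrow> real ^ 'm" where
  "p1 v = (\<chi> i. v $ Inl i)"

definition p2 :: "real ^ ('m::finite + 'n::finite) \<Rightarrow> real ^ 'n" where
  "p2 v = (\<chi> j. v $ Inr j)"

definition mixed_norm :: "real ^ ('m::finite + 'n::finite) \<Rightarrow> real" where
  "mixed_norm v = max (norm (p1 v)) (norm (p2 v))"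

definition block_matrix ::
  "real ^ 'm ^ 'm \<Rightarrow> real ^ 'n ^ 'm \<Rightarrow> real ^ 'm ^ 'n \<Rightarrow> real ^ 'n ^ 'n \<Rightarrow> real ^ ('m::finite + 'n::finite) ^ ('m + 'n)"
where
  "block_matrix P Q R S = (\<chi> i j. case i of
      Inl a \<Rightarrow> (case j of Inl b \<Rightarrow> P $ a $ b | Inr b \<Rightarrow> Q $ a $ b)
    | Inr a \<Rightarrow> (case j of Inl b \<Rightarrow> R $ a $ b | Inr b \<Rightarrow> S $ a $ b))"

definition int_vecs :: "(real ^ 'd) set" where
  "int_vecs = {v. \<forall>i. v $ i \<in> \<int>}"


section \<open>The space of affine unimodular lattices\<close>

text \<open>The pair \<open>(g, w)\<close> stands for the affine map \<open>u \<mapsto> g u + w\<close>; multiplication is composition.\<close>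

type_synonym 'd affine = "(real ^ 'd ^ 'd) \<times> (real ^ 'd)"

definition affine_SL :: "('d::finite) affine monoid" where
  "affine_SL = \<lparr> carrier = {(g, w). det g = 1},
                 monoid.mult = (\<lambda>(g, w) (g', w'). (g ** g', g *v w' + w)),
                 one = (mat 1, 0) \<rparr>"

definition affine_SL_int :: "('d::finite) affine set" where
  "affine_SL_int = {(g, w). det g = 1 \<and> (\<forall>i j. g $ i $ j \<in> \<int>) \<and> w \<in> int_vecs}"

definition affine_lattices :: "('d::finite) affine set set" where
  "affine_lattices = lcosets\<^bsub>affine_SL\<^esub> affine_SL_int"

definition affine_class :: "real ^ 'd ^ 'd \<Rightarrow> real ^ 'd \<Rightarrow> ('d::finite) affine set" where
  "affine_class g w = (g, w) <#\<^bsub>affine_SL\<^esub> affine_SL_int"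

definition act :: "real ^ 'd ^ 'd \<Rightarrow> ('d::finite) affine set \<Rightarrow> 'd affine set" where
  "act h x = (h, 0) <#\<^bsub>affine_SL\<^esub> x"

text \<open>
  All representatives \<open>(g, w)\<close> of a coset give the same set \<open>g \<int>\<^sup>d + w\<close>, so the union over
  representatives taken here is that set; see \<open>lattice_of_rep\<close> below.
\<close>

definition lattice_of :: "('d::finite) affine set \<Rightarrow> (real ^ 'd) set" where
  "lattice_of x = (\<Union>(g, w)\<in>x. (\<lambda>u. g *v u + w) ` int_vecs)"


section \<open>The exponents\<close>

text \<open>
  Suprema, logarithms and upper limits are taken in \<open>[-\<infinity>, \<infinity>]\<close>, so that no boundedness has to be
  assumed; \<open>1 / 0 = \<infinity>\<close> and \<open>1 / \<infinity> = 0\<close> in \<^typ>\<open>ereal\<close>.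
\<close>

definition ext_ln :: "ereal \<Rightarrow> ereal" where
  "ext_ln x = (if x \<le> 0 then -\<infinity> else if x = \<infinity> then \<infinity> else ereal (ln (real_of_ereal x)))"

definition \<alpha>\<^sub>1 :: "('m::finite + 'n::finite) affine set \<Rightarrow> ereal" where
  "\<alpha>\<^sub>1 x = (SUP v\<in>lattice_of x. 1 / ereal (mixed_norm v))"

definition g_flow :: "real \<Rightarrow> real ^ ('m::finite + 'n::finite) ^ ('m + 'n)" where
  "g_flow t = (let m = real CARD('m); n = real CARD('n); d = m + n in
     block_matrix (exp (n * t / d) *\<^sub>R mat 1) 0 0 (exp (- m * t / d) *\<^sub>R mat 1))"

definition h_mat :: "real ^ 'm ^ 'n \<Rightarrow> real ^ ('m::finite + 'n::finite) ^ ('m + 'n)" where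
  "h_mat B = block_matrix (mat 1) 0 B (mat 1)"

text \<open>The norm on \<^typ>\<open>real ^ 'm ^ 'n\<close> is the Euclidean (Frobenius) norm of the entries.\<close>

definition h_ball :: "real \<Rightarrow> (real ^ ('m::finite + 'n::finite) ^ ('m + 'n)) set" where
  "h_ball s = {h_mat B | B. norm B \<le> s}"

definition beta_exponent :: "('m::finite + 'n::finite) affine set \<Rightarrow> ereal" where
  "beta_exponent x =
     Limsup at_top (\<lambda>s::real. (SUP h\<in>h_ball s. ext_ln (\<alpha>\<^sub>1 (act h x))) / ereal (ln s))"

definition gamma_exponent :: "('m::finite + 'n::finite) affine set \<Rightarrow> ereal" where
  "gamma_exponent x = Limsup at_top (\<lambda>t::real. ext_ln (\<alpha>\<^sub>1 (act (g_flow t) x)) / ereal t)"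

definition x_point :: "real ^ 'n ^ 'm \<Rightarrow> real ^ ('m + 'n) \<Rightarrow> ('m::finite + 'n::finite) affine set" where
  "x_point A v\<^sub>0 = affine_class (block_matrix (mat 1) (- A) 0 (mat 1)) v\<^sub>0"

definition dioph_exponent :: "real ^ 'n ^ 'm \<Rightarrow> real ^ ('m::finite + 'n::finite) \<Rightarrow> ereal" where
  "dioph_exponent A v\<^sub>0 = Sup (ereal ` {\<nu>. \<nu> > 0 \<and>
     infinite {v \<in> int_vecs. p2 v \<noteq> 0 \<and>
       norm (A *v p2 v - p1 (v + v\<^sub>0)) \<le> norm (p2 v) powr (- (\<nu> - 1))}})"


section \<open>Basic properties\<close>

lemma int_vecs_add: "u \<in> int_vecs \<Longrightarrow> v \<in> int_vecs \<Longrightarrow> u + v \<in> int_vecs"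
  by (auto simp: int_vecs_def)

lemma int_vecs_mult:
  fixes g :: "real ^ 'd ^ ('d::finite)"
  assumes "\<forall>i j. g $ i $ j \<in> \<int>" "u \<in> int_vecs"
  shows "g *v u \<in> int_vecs"
  using assms by (auto simp: int_vecs_def matrix_vector_mult_def intro!: Ints_sum Ints_mult)

lemma group_affine_SL: "group (affine_SL :: ('d::finite) affine monoid)"
proof (rule groupI)
  fix x :: "'d affine"
  assume "x \<in> carrier affine_SL"
  then obtain g w where x: "x = (g, w)" and g: "det g = 1"
    by (auto simp: affine_SL_def)
  obtain k where k: "k ** g = mat 1"
    using g invertible_det_nz[of g] by (auto simp: invertible_def)
  then have "det k = 1"
    using g by (metis det_I det_mul mult.right_neutral)
  with k show "\<exists>y\<in>carrier affine_SL. y \<otimes>\<^bsub>affine_SL\<^esub> x = \<one>\<^bsub>affine_SL\<^esub>"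
    by (intro bexI[of _ "(k, - (k *v w))"]) (auto simp: x affine_SL_def)
qed (auto simp: affine_SL_def det_mul matrix_mul_assoc matrix_vector_mul_assoc
       matrix_vector_right_distrib)

lemma affine_SL_mult [simp]:
  "(g, w) \<otimes>\<^bsub>affine_SL\<^esub> (g', w') = (g ** g', g *v w' + w)"
  by (simp add: affine_SL_def)

lemma det_Ints:
  fixes g :: "real ^ 'd ^ ('d::finite)"
  assumes "\<forall>i j. g $ i $ j \<in> \<int>"
  shows "det g \<in> \<int>"
  using assms unfolding det_def by (intro Ints_sum Ints_mult Ints_prod) auto

lemma Ints_solution:
  fixes g :: "real ^ 'd ^ ('d::finite)"
  assumes "\<forall>i j. g $ i $ j \<in> \<int>" "det g = 1" "g *v u \<in> int_vecs"
  shows "u \<in> int_vecs"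
proof -
  have "u = (\<chi> k. det (\<chi> i j. if j = k then (g *v u) $ i else g $ i $ j) / det g)"
    using cramer[of g u "g *v u"] assms(2) by simp
  then have "u $ k = det (\<chi> i j. if j = k then (g *v u) $ i else g $ i $ j)" for k
    using assms(2) by (metis (no_types, lifting) div_by_1 vec_lambda_beta)
  then show ?thesis
    using assms(1,3) by (auto simp: int_vecs_def intro!: det_Ints)
qed

lemma subgroup_affine_SL_int: "subgroup affine_SL_int (affine_SL :: ('d::finite) affine monoid)"
proof (rule group.subgroupI[OF group_affine_SL])
  show "affine_SL_int \<subseteq> carrier (affine_SL :: 'd affine monoid)"
    by (auto simp: affine_SL_int_def affine_SL_def)
  have "(mat 1, 0) \<in> (affine_SL_int :: 'd affine set)"
    by (simp add: affine_SL_int_def int_vecs_def) (simp add: mat_def)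
  then show "affine_SL_int \<noteq> ({} :: 'd affine set)" by blast
next
  fix x :: "'d affine"
  assume x: "x \<in> affine_SL_int"
  obtain g w where gw: "x = (g, w)" by fastforce
  obtain k z where kz: "inv\<^bsub>affine_SL\<^esub> x = (k, z)" by fastforce
  have xc: "x \<in> carrier affine_SL"
    using x by (auto simp: affine_SL_int_def affine_SL_def)
  have one: "\<one>\<^bsub>affine_SL\<^esub> = (mat 1 :: real ^ 'd ^ 'd, 0 :: real ^ 'd)"
    by (simp add: affine_SL_def)
  have "x \<otimes>\<^bsub>affine_SL\<^esub> (inv\<^bsub>affine_SL\<^esub> x) = \<one>\<^bsub>affine_SL\<^esub>"
    using group.r_inv[OF group_affine_SL xc] .
  then have "(g, w) \<otimes>\<^bsub>affine_SL\<^esub> (k, z) = (mat 1, 0)"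
    unfolding kz one unfolding gw .
  then have gk: "g ** k = mat 1" "g *v z + w = 0"
    by simp_all
  have "(k, z) \<in> carrier affine_SL"
    using group.inv_closed[OF group_affine_SL xc] kz by simp
  then have "det k = 1" by (simp add: affine_SL_def)
  have g: "\<forall>i j. g $ i $ j \<in> \<int>" "det g = 1" "w \<in> int_vecs"
    using x by (auto simp: gw affine_SL_int_def)
  have "g *v z \<in> int_vecs"
    using g(3) gk(2) by (auto simp: int_vecs_def eq_neg_iff_add_eq_0[symmetric])
  then have z: "z \<in> int_vecs" by (rule Ints_solution[OF g(1,2)])
  have "column j k \<in> int_vecs" for j
  proof (rule Ints_solution[OF g(1,2)])
    have "g *v column j k = column j (mat 1)"
      unfolding gk(1)[symmetric]
      by (simp add: vec_eq_iff column_def matrix_matrix_mult_def matrix_vector_mult_def)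
    then show "g *v column j k \<in> int_vecs"
      by (auto simp: int_vecs_def column_def mat_def)
  qed
  then have "\<forall>i j. k $ i $ j \<in> \<int>" by (auto simp: int_vecs_def column_def)
  with z \<open>det k = 1\<close> show "inv\<^bsub>affine_SL\<^esub> x \<in> affine_SL_int"
    by (simp add: kz affine_SL_int_def)
next
  fix x y :: "'d affine"
  assume "x \<in> affine_SL_int" "y \<in> affine_SL_int"
  then show "x \<otimes>\<^bsub>affine_SL\<^esub> y \<in> affine_SL_int"
    by (auto simp: affine_SL_int_def det_mul intro!: int_vecs_add int_vecs_mult)
       (auto simp: matrix_matrix_mult_def intro!: Ints_sum Ints_mult)
qed

lemma lattice_of_affine_class:
  fixes g :: "real ^ 'd ^ ('d::finite)"
  shows "lattice_of (affine_class g w) = (\<lambda>u. g *v u + w) ` int_vecs"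
proof (intro equalityI subsetI)
  fix y assume "y \<in> lattice_of (affine_class g w)"
  then obtain k z u where "(k, z) \<in> affine_SL_int" and u: "u \<in> int_vecs"
    and y: "y = (g ** k) *v u + (g *v z + w)"
    by (fastforce simp: lattice_of_def affine_class_def l_coset_def)
  then have k: "\<forall>i j. k $ i $ j \<in> \<int>" "z \<in> int_vecs"
    by (auto simp: affine_SL_int_def)
  have "y = g *v (k *v u + z) + w"
    by (simp add: y matrix_vector_mul_assoc matrix_vector_right_distrib)
  moreover have "k *v u + z \<in> int_vecs"
    using k u by (intro int_vecs_add int_vecs_mult)
  ultimately show "y \<in> (\<lambda>u. g *v u + w) ` int_vecs" by blast
next
  fix y assume y: "y \<in> (\<lambda>u. g *v u + w) ` int_vecs"
  have "(mat 1, 0) \<in> (affine_SL_int :: 'd affine set)"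
    by (simp add: affine_SL_int_def int_vecs_def) (simp add: mat_def)
  then have "(g, w) \<in> affine_class g w"
    unfolding affine_class_def l_coset_def by force
  then show "y \<in> lattice_of (affine_class g w)"
    using y unfolding lattice_of_def by blast
qed

lemma lattice_of_rep:
  fixes g :: "real ^ 'd ^ ('d::finite)"
  assumes "x \<in> affine_lattices" "(g, w) \<in> x"
  shows "lattice_of x = (\<lambda>u. g *v u + w) ` int_vecs"
proof -
  obtain a where a: "a \<in> carrier affine_SL" "x = a <#\<^bsub>affine_SL\<^esub> affine_SL_int"
    using assms(1) by (auto simp: affine_lattices_def LCOSETS_def)
  then have "x = affine_class g w"
    using group.l_repr_independence[OF group_affine_SL _ a(1) subgroup_affine_SL_int, of "(g, w)"]
      assms(2) by (simp add: affine_class_def)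
  then show ?thesis by (simp add: lattice_of_affine_class)
qed

lemma act_affine_class: "act h (affine_class g w) = affine_class (h ** g) (h *v w)"
  by (force simp: act_def affine_class_def l_coset_def matrix_mul_assoc
        matrix_vector_mul_assoc matrix_vector_right_distrib)

lemma lattice_of_act: "lattice_of (act h x) = (*v) h ` lattice_of x"
  by (force simp: lattice_of_def act_def l_coset_def
        matrix_vector_mul_assoc matrix_vector_right_distrib)

lemma UNIV_sum_Plus: "sum f (UNIV :: ('a::finite + 'b::finite) set) =
    (\<Sum>a\<in>UNIV. f (Inl a)) + (\<Sum>b\<in>UNIV. f (Inr b))"
  by (subst UNIV_Plus_UNIV[symmetric], subst sum.Plus) (auto simp: o_def)

lemma block_matrix_mult:
  "block_matrix P Q R S ** block_matrix P' Q' R' S' =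
   block_matrix (P ** P' + Q ** R') (P ** Q' + Q ** S') (R ** P' + S ** R') (R ** Q' + S ** S')"
  by (auto simp: vec_eq_iff matrix_matrix_mult_def block_matrix_def UNIV_sum_Plus
        split: sum.split)

lemma transpose_block_matrix:
  "transpose (block_matrix P Q R S) = block_matrix (transpose P) (transpose R) (transpose Q) (transpose S)"
  by (auto simp: vec_eq_iff transpose_def block_matrix_def split: sum.split)

lemma block_matrix_1: "block_matrix (mat 1) 0 0 (mat 1) = mat 1"
  by (auto simp: vec_eq_iff mat_def block_matrix_def split: sum.split)

lemma det_h_mat: "det (h_mat B :: real ^ ('m::finite + 'n::finite) ^ ('m + 'n)) = 1"
proof -
  have add: "h_mat B ** h_mat C = h_mat (B + C)" for B C :: "real ^ 'm ^ 'n"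
    by (simp add: h_mat_def block_matrix_mult add.commute)
  define D :: "real ^ ('m + 'n) ^ ('m + 'n)" where "D = block_matrix (mat 1) 0 0 (- mat 1)"
  have neg1: "(- mat 1) ** C = - C" for C :: "real ^ 'k ^ 'n"
    by (simp add: vec_eq_iff matrix_matrix_mult_def mat_def if_distrib if_distribR
          sum_negf cong: if_cong)
  have neg2: "C ** (- mat 1) = - C" for C :: "real ^ 'n ^ 'n"
    by (simp add: vec_eq_iff matrix_matrix_mult_def mat_def if_distrib if_distribR
          sum_negf cong: if_cong)
  have "D ** D = mat 1"
    by (simp add: D_def block_matrix_mult neg1 block_matrix_1)
  then have "det D * det D = 1" by (metis det_I det_mul)
  moreover have "D ** h_mat B ** D = h_mat (- B)"
    by (simp add: D_def h_mat_def block_matrix_mult neg1 neg2)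
  ultimately have neg: "det (h_mat (- B)) = det (h_mat B)"
    by (metis det_mul mult.assoc mult.commute mult_1)
  have "det (h_mat B) * det (h_mat (- B)) = 1"
    using add[of B "- B"] by (metis add.right_inverse block_matrix_1 det_I det_mul h_mat_def)
  then have "(det (h_mat B))\<^sup>2 = 1"
    by (simp add: neg power2_eq_square)
  moreover have "det (h_mat B) = (det (h_mat ((1/2) *\<^sub>R B)))\<^sup>2"
    using add[of "(1/2) *\<^sub>R B" "(1/2) *\<^sub>R B"]
    by (simp add: power2_eq_square det_mul[symmetric] scaleR_add_left[symmetric])
  ultimately show ?thesis
    by (metis power2_eq_1_iff zero_le_power2 neg_0_le_iff_le not_one_le_zero)
qed

lemma det_g_flow: "det (g_flow t :: real ^ ('m::finite + 'n::finite) ^ ('m + 'n)) = 1"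
proof -
  have P: "prod f UNIV = (\<Prod>a\<in>UNIV. f (Inl a)) * (\<Prod>b\<in>UNIV. f (Inr b))" for f :: "'m + 'n \<Rightarrow> real"
    by (subst UNIV_Plus_UNIV[symmetric], subst prod.Plus) (auto simp: o_def)
  show ?thesis
    by (subst det_diagonal)
       (auto simp: P g_flow_def Let_def block_matrix_def mat_def exp_of_nat_mult[symmetric]
          exp_add[symmetric] split: sum.split)
qed

lemma x_point_in: "x_point A v\<^sub>0 \<in> affine_lattices"
proof -
  have "block_matrix (mat 1) (- A) 0 (mat 1) = transpose (h_mat (transpose (- A)))"
    by (simp add: h_mat_def transpose_block_matrix transpose_mat)
       (simp add: transpose_def vec_eq_iff block_matrix_def split: sum.split)
  then have "det (block_matrix (mat 1) (- A) 0 (mat 1)) = 1"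
    by (simp add: det_transpose det_h_mat)
  then show ?thesis
    by (auto simp: x_point_def affine_class_def affine_lattices_def LCOSETS_def affine_SL_def)
qed

end

theory Submission
  imports Defs
begin

text \<open>
  For an integer vector \<open>u\<close> put \<open>a\<^sub>u = \<parallel>A p\<^sub>2(u) - p\<^sub>1(u + v\<^sub>0)\<parallel>\<close> and \<open>b\<^sub>u = \<parallel>p\<^sub>2(u + v\<^sub>0)\<parallel>\<close>, the norms of
  the two projections of the lattice point attached to \<open>u\<close>. All three quantities depend only
  on the pairs \<open>(a\<^sub>u, b\<^sub>u)\<close>, and each of them is the threshold of a condition on a real
  number \<open>\<tau>\<close>, asking that for arbitrarily large \<open>t\<close> some \<open>u\<close> satisfies

  \<^item> for \<open>n/d + \<gamma>\<close> (\<open>threshold_gamma\<close>): \<open>a\<^sub>u < e\<^bsup>-\<tau>t\<^esup>\<close> and \<open>b\<^sub>u < e\<^bsup>(1-\<tau>)t\<^esup>\<close>, because multiplying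
    \<open>g\<^sub>t v\<close> by the scalar \<open>e\<^bsup>-nt/d\<^esup>\<close> turns its mixed norm into \<open>max(a\<^sub>u, e\<^bsup>-t\<^esup> b\<^sub>u)\<close>;

  \<^item> for \<open>\<beta>\<close>, with \<open>s = e\<^sup>t\<close> (\<open>threshold_beta\<close>): \<open>a\<^sub>u < e\<^bsup>-\<tau>t\<^esup>\<close> and \<open>b\<^sub>u - e\<^sup>t a\<^sub>u < e\<^bsup>-\<tau>t\<^esup>\<close>, because
    over \<open>\<parallel>B\<parallel> \<le> s\<close> the vector \<open>B y + q\<close> can be made as short as \<open>max(0, \<parallel>q\<parallel> - s \<parallel>y\<parallel>)\<close> and no
    shorter (\<open>exists_shear_iff\<close>).

  The second condition for \<open>\<tau>\<close> implies the first one for every smaller \<open>\<tau>'\<close> since \<open>b\<^sub>u < 2 e\<^bsup>(1-\<tau>)t\<^esup>\<close>.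
  Conversely, given \<open>u\<close> and \<open>t\<close> as in the first condition, enlarge \<open>t\<close> to \<open>t' = max(t, ln(b\<^sub>u / a\<^sub>u))\<close>, so
  that \<open>b\<^sub>u - e\<^bsup>t'\<^esup> a\<^sub>u \<le> 0\<close>; the bound \<open>a\<^sub>u < e\<^bsup>-\<tau>'t'\<^esup>\<close> persists for
  \<open>0 \<le> \<tau>' < \<tau>\<close>, and negative \<open>\<tau>'\<close> satisfy the second condition trivially
  (\<open>shear_imp_flow\<close>, \<open>flow_imp_shear\<close>). Here \<open>a\<^sub>u > 0\<close> is the hypothesis on \<open>A\<close>, and \<open>b\<^sub>u\<close> is
  bounded below because the coordinates of \<open>v\<^sub>0\<close> are not integers.

  Finally, if \<open>b\<^sub>u\<close> is about \<open>e\<^bsup>(1-\<tau>)t\<^esup>\<close>, then \<open>e\<^bsup>-\<tau>t\<^esup>\<close> is about \<open>b\<^sub>u\<close> to the power \<open>-\<tau>/(1-\<tau>)\<close>, and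
  \<open>\<tau>/(1-\<tau>) = \<nu> - 1\<close> for \<open>\<nu> = 1/(1-\<tau>)\<close>. Hence \<open>1 - 1/\<mu>\<close> is the threshold of the first condition
  too (\<open>threshold_dioph\<close>); small \<open>\<tau>\<close> are covered by \<open>\<mu> \<ge> 1\<close>.
\<close>

section \<open>Thresholds\<close>

text \<open>
  The condition \<open>P\<close> holds for all reals below \<open>x\<close> and for none above \<open>x\<close>; nothing is said at \<open>x\<close>
  itself. For \<open>x = \<plusminus>\<infinity>\<close> the condition holds always or never.
\<close>

definition is_threshold :: "(real \<Rightarrow> bool) \<Rightarrow> ereal \<Rightarrow> bool" where
  "is_threshold P x \<longleftrightarrow> (\<forall>\<tau>. ereal \<tau> < x \<longrightarrow> P \<tau>) \<and> (\<forall>\<tau>. P \<tau> \<longrightarrow> ereal \<tau> \<le> x)"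

lemma ereal_le_by_reals:
  fixes x y :: ereal
  assumes "\<And>\<tau>. ereal \<tau> < x \<Longrightarrow> ereal \<tau> \<le> y"
  shows "x \<le> y"
proof (rule ccontr)
  assume "\<not> x \<le> y"
  then obtain \<tau> where "y < ereal \<tau>" "ereal \<tau> < x"
    using ereal_dense2[of y x] by (auto simp: not_le)
  with assms show False by (meson not_le)
qed

lemma threshold_unique:
  assumes "is_threshold P x" "is_threshold P y"
  shows "x = y"
proof (rule antisym)
  show "x \<le> y" using assms by (auto simp: is_threshold_def intro: ereal_le_by_reals[of x y])
  show "y \<le> x" using assms by (auto simp: is_threshold_def intro: ereal_le_by_reals[of y x])
qed

text \<open>Two conditions that imply each other up to an arbitrarily small loss share their threshold.\<close>

lemma threshold_transfer:
  assumes "is_threshold P x"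
    and PQ: "\<And>\<tau> \<tau>'. P \<tau> \<Longrightarrow> \<tau>' < \<tau> \<Longrightarrow> Q \<tau>'"
    and QP: "\<And>\<tau> \<tau>'. Q \<tau> \<Longrightarrow> \<tau>' < \<tau> \<Longrightarrow> P \<tau>'"
  shows "is_threshold Q x"
  unfolding is_threshold_def
proof (intro conjI allI impI)
  fix \<tau> assume "ereal \<tau> < x"
  then obtain \<sigma> where "ereal \<tau> < ereal \<sigma>" "ereal \<sigma> < x"
    using ereal_dense2 by blast
  then show "Q \<tau>"
    using assms(1) PQ[of \<sigma> \<tau>] by (auto simp: is_threshold_def)
next
  fix \<tau> assume "Q \<tau>"
  then show "ereal \<tau> \<le> x"
    using assms(1) QP[of \<tau>]
    by (auto simp: is_threshold_def intro: ereal_le_by_reals[of "ereal \<tau>" x])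
qed

lemma threshold_shift:
  assumes "is_threshold P x"
  shows "is_threshold (\<lambda>\<tau>. P (\<tau> - c)) (ereal c + x)"
proof -
  have "ereal \<tau> < ereal c + x \<longleftrightarrow> ereal (\<tau> - c) < x"
    "ereal \<tau> \<le> ereal c + x \<longleftrightarrow> ereal (\<tau> - c) \<le> x" for \<tau>
    by (cases x; auto)+
  with assms show ?thesis by (auto simp: is_threshold_def)
qed

lemma threshold_Limsup:
  fixes f :: "'a \<Rightarrow> ereal"
  assumes "\<And>\<tau>. \<forall>\<^sub>F t in F. ereal \<tau> < f t \<longleftrightarrow> p \<tau> t"
  shows "is_threshold (\<lambda>\<tau>. \<exists>\<^sub>F t in F. p \<tau> t) (Limsup F f)"
  unfolding is_threshold_def
proof (intro conjI allI impI)
  fix \<tau> assume "ereal \<tau> < Limsup F f"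
  show "\<exists>\<^sub>F t in F. p \<tau> t"
  proof (rule ccontr)
    assume "\<not> ?thesis"
    then have "\<forall>\<^sub>F t in F. \<not> p \<tau> t" by (simp add: frequently_def)
    then have "\<forall>\<^sub>F t in F. f t \<le> ereal \<tau>"
      using assms[of \<tau>] by eventually_elim auto
    then have "Limsup F f \<le> ereal \<tau>" by (rule Limsup_bounded)
    with \<open>ereal \<tau> < Limsup F f\<close> show False by simp
  qed
next
  fix \<tau> assume *: "\<exists>\<^sub>F t in F. p \<tau> t"
  show "ereal \<tau> \<le> Limsup F f"
  proof (rule ccontr)
    assume "\<not> ?thesis"
    then have "\<forall>\<^sub>F t in F. f t < ereal \<tau>"
      by (intro Limsup_lessD) auto
    then have "\<forall>\<^sub>F t in F. \<not> p \<tau> t"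
      using assms[of \<tau>] by eventually_elim auto
    with * show False by (simp add: frequently_def)
  qed
qed

lemma frequently_at_top_ln:
  "(\<exists>\<^sub>F s in at_top. P (ln s)) \<longleftrightarrow> (\<exists>\<^sub>F t::real in at_top. P t)"
proof -
  have "(\<forall>\<^sub>F s in at_top. \<not> P (ln s)) \<longleftrightarrow> (\<forall>\<^sub>F t::real in at_top. \<not> P t)" (is "?l \<longleftrightarrow> ?r")
  proof
    assume ?l
    then have "\<forall>\<^sub>F t in at_top. \<not> P (ln (exp t))"
      using exp_at_top by (rule eventually_compose_filterlim)
    then show ?r by simp
  next
    assume ?r
    then show ?l using ln_at_top by (rule eventually_compose_filterlim)
  qed
  then show ?thesis by (simp add: frequently_def)
qed

section \<open>Comparison of the diagonal flow and the shears\<close>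

text \<open>
  The condition for \<open>n/d + \<gamma>\<close>, for an arbitrary family of pairs \<open>(a i, b i)\<close>: at arbitrarily
  large times \<open>t\<close> some pair satisfies \<open>max (a i) (e\<^bsup>-t\<^esup> b i) < e\<^bsup>-\<tau>t\<^esup>\<close>.
\<close>

definition flow_rate :: "'i set \<Rightarrow> ('i \<Rightarrow> real) \<Rightarrow> ('i \<Rightarrow> real) \<Rightarrow> real \<Rightarrow> bool" where
  "flow_rate I a b \<tau> \<longleftrightarrow>
     (\<exists>\<^sub>F t in at_top. \<exists>i\<in>I. a i < exp (- (\<tau> * t)) \<and> b i < exp ((1 - \<tau>) * t))"

text \<open>
  The condition for \<open>\<beta>\<close>, where shears of norm at most \<open>e\<^sup>t\<close> are allowed; the parameter \<open>t\<close> is the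
  logarithm of the radius \<open>s\<close>.
\<close>

definition shear_rate :: "'i set \<Rightarrow> ('i \<Rightarrow> real) \<Rightarrow> ('i \<Rightarrow> real) \<Rightarrow> real \<Rightarrow> bool" where
  "shear_rate I a b \<tau> \<longleftrightarrow>
     (\<exists>\<^sub>F t in at_top. \<exists>i\<in>I. a i < exp (- (\<tau> * t)) \<and> b i - exp t * a i < exp (- (\<tau> * t)))"

lemma frequently_at_top_iff:
  "(\<exists>\<^sub>F t in at_top. P t) \<longleftrightarrow> (\<forall>T::real. \<exists>t>T. P t)"
  unfolding frequently_def eventually_at_top_dense by auto

lemma eventually_less_exp:
  assumes "0 < (c::real)"
  shows "\<forall>\<^sub>F t in at_top. K < exp (c * t)"
proof -
  have "filterlim (\<lambda>t. exp (c * t)) at_top at_top"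
    using assms by (intro filterlim_compose[OF exp_at_top] filterlim_tendsto_pos_mult_at_top[of _ c])
      (auto simp: filterlim_ident)
  then show ?thesis by (simp add: filterlim_at_top_dense)
qed

lemma eventually_less_powr:
  assumes "0 < (c::real)"
  shows "\<forall>\<^sub>F x::real in at_top. K < x powr c"
proof -
  have "\<forall>\<^sub>F x in at_top. K < exp (c * ln x)"
    using eventually_less_exp[OF assms] ln_at_top by (rule eventually_compose_filterlim)
  then show ?thesis
    using eventually_gt_at_top[of 0] by eventually_elim (simp add: powr_def)
qed

lemma flow_rate_neg:
  assumes "I \<noteq> {}" "\<tau> < 0"
  shows "flow_rate I a b \<tau>"
proof -
  obtain i where i: "i \<in> I" using assms(1) by blast
  have "\<forall>\<^sub>F t in at_top. a i < exp ((- \<tau>) * t)" "\<forall>\<^sub>F t in at_top. b i < exp ((1 - \<tau>) * t)"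
    using assms(2) by (intro eventually_less_exp; simp)+
  then have "\<forall>\<^sub>F t in at_top. \<exists>i\<in>I. a i < exp (- (\<tau> * t)) \<and> b i < exp ((1 - \<tau>) * t)"
    by eventually_elim (use i in auto)
  then show ?thesis unfolding flow_rate_def by (rule eventually_frequently[rotated]) simp
qed

lemma flow_rate_le_1:
  assumes "flow_rate I a b \<tau>" "0 < c" "\<And>i. i \<in> I \<Longrightarrow> c \<le> b i"
  shows "\<tau> \<le> 1"
proof (rule ccontr)
  assume "\<not> \<tau> \<le> 1"
  then have "\<forall>\<^sub>F t in at_top. 1 / c < exp ((\<tau> - 1) * t)"
    by (intro eventually_less_exp) simp
  moreover have "\<exists>\<^sub>F t in at_top. c < exp ((1 - \<tau>) * t)"
    using assms(1) unfolding flow_rate_def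
    by (rule frequently_elim1) (use assms(3) in force)
  ultimately have "\<exists>\<^sub>F t in at_top. 1 / c < exp ((\<tau> - 1) * t) \<and> c < exp ((1 - \<tau>) * t)"
    by (rule frequently_eventually_conj[rotated])
  then obtain t where t: "1 / c < exp ((\<tau> - 1) * t)" "c < exp ((1 - \<tau>) * t)"
    using frequently_ex by blast
  have "c * (1 / c) < exp ((1 - \<tau>) * t) * exp ((\<tau> - 1) * t)"
    using t \<open>0 < c\<close> by (intro mult_strict_mono) auto
  also have "\<dots> = 1" by (simp add: exp_add[symmetric] algebra_simps)
  finally show False using \<open>0 < c\<close> by simp
qed

lemma shear_imp_flow:
  assumes "shear_rate I a b \<tau>" "\<tau>' < \<tau>"
  shows "flow_rate I a b \<tau>'"
proof -
  have "\<forall>\<^sub>F t in at_top. 2 < exp ((\<tau> - \<tau>') * t)"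
    using assms(2) by (intro eventually_less_exp) simp
  moreover have "\<forall>\<^sub>F t::real in at_top. 0 < t" by (rule eventually_gt_at_top)
  ultimately have ev: "\<forall>\<^sub>F t in at_top. 2 < exp ((\<tau> - \<tau>') * t) \<and> 0 < t" by eventually_elim auto
  show ?thesis unfolding flow_rate_def
  proof (rule frequently_rev_mp[OF assms(1)[unfolded shear_rate_def]],
      rule eventually_mono[OF ev], safe)
    fix t i
    assume t: "2 < exp ((\<tau> - \<tau>') * t)" "0 < t" and i: "i \<in> I"
      and a: "a i < exp (- (\<tau> * t))" and b: "b i - exp t * a i < exp (- (\<tau> * t))"
    have "exp (- (\<tau> * t)) \<le> exp (- (\<tau>' * t))"
      using t assms(2) by simp
    then have a': "a i < exp (- (\<tau>' * t))" by (rule less_le_trans[OF a])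
    have "b i < exp t * a i + exp (- (\<tau> * t))" using b by simp
    also have "\<dots> \<le> exp t * exp (- (\<tau> * t)) + exp t * exp (- (\<tau> * t))"
      using a t by (intro add_mono) auto
    also have "\<dots> = 2 * exp ((1 - \<tau>) * t)"
      by (simp add: exp_add[symmetric] algebra_simps)
    also have "\<dots> \<le> exp ((\<tau> - \<tau>') * t) * exp ((1 - \<tau>) * t)"
      using t by (intro mult_right_mono) auto
    also have "\<dots> = exp ((1 - \<tau>') * t)"
      by (simp add: exp_add[symmetric] algebra_simps)
    finally show "\<exists>i\<in>I. a i < exp (- (\<tau>' * t)) \<and> b i < exp ((1 - \<tau>') * t)"
      using i a' by blast
  qed
qed

lemma shear_rate_neg:
  assumes "I \<noteq> {}" "\<tau> < 0" "\<And>i. i \<in> I \<Longrightarrow> 0 < a i"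
  shows "shear_rate I a b \<tau>"
proof -
  obtain i where i: "i \<in> I" using assms(1) by blast
  have "\<forall>\<^sub>F t in at_top. a i < exp ((- \<tau>) * t)" "\<forall>\<^sub>F t in at_top. b i / a i < exp (1 * t)"
    using assms(2) by (intro eventually_less_exp; simp)+
  then have "\<forall>\<^sub>F t in at_top. \<exists>i\<in>I. a i < exp (- (\<tau> * t)) \<and>
      b i - exp t * a i < exp (- (\<tau> * t))"
  proof eventually_elim
    case (elim t)
    have "b i - exp t * a i < 0"
      using elim(2) assms(3)[OF i] by (simp add: divide_less_eq)
    then have "b i - exp t * a i < exp (- (\<tau> * t))" by (rule less_trans) simp
    with elim(1) i show ?case by auto
  qed
  then show ?thesis unfolding shear_rate_def by (rule eventually_frequently[rotated]) simp
qed

lemma flow_imp_shear: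
  assumes "flow_rate I a b \<tau>" "\<tau>' < \<tau>" "I \<noteq> {}"
    and a: "\<And>i. i \<in> I \<Longrightarrow> 0 < a i" and c: "0 < c" "\<And>i. i \<in> I \<Longrightarrow> c \<le> b i"
  shows "shear_rate I a b \<tau>'"
proof (cases "\<tau>' < 0")
  case True
  then show ?thesis using assms by (intro shear_rate_neg)
next
  case False
  have \<tau>: "\<tau> \<le> 1" using flow_rate_le_1[OF assms(1) c] .
  show ?thesis
    unfolding shear_rate_def frequently_at_top_iff
  proof
    fix T :: real
    obtain t i where t: "t > max T 0" and i: "i \<in> I"
      and ai: "a i < exp (- (\<tau> * t))" and bi: "b i < exp ((1 - \<tau>) * t)"
      using assms(1)[unfolded flow_rate_def frequently_at_top_iff, rule_format, of "max T 0"] by blast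
    have pos: "0 < a i" "0 < b i" using a c i by (auto intro: less_le_trans)
    \<comment> \<open>The least time \<open>t' \<ge> t\<close> at which the shears can cancel the second component.\<close>
    define t' where "t' = max t (ln (b i / a i))"
    have "b i / a i \<le> exp t'"
      using pos by (subst ln_le_cancel_iff[symmetric]) (auto simp: t'_def)
    then have "b i - exp t' * a i \<le> 0" using pos by (simp add: divide_le_eq)
    then have b': "b i - exp t' * a i < exp (- (\<tau>' * t'))" by (rule le_less_trans) simp
    have la: "ln (a i) < - (\<tau> * t)" and lb: "ln (b i) < (1 - \<tau>) * t"
      using ai bi pos by (metis exp_less_cancel_iff exp_ln)+
    have "ln (a i) < - (\<tau>' * t')"
    proof (cases "t' = t")
      case True
      have "\<tau>' * t \<le> \<tau> * t" using assms(2) t by (intro mult_right_mono) auto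
      with la show ?thesis unfolding True by linarith
    next
      case False
      then have t': "t' = ln (b i) - ln (a i)"
        using pos by (auto simp: t'_def ln_div max_def split: if_splits)
      have "\<tau>' * ln (b i) \<le> \<tau>' * ((1 - \<tau>) * t)"
        using lb \<open>\<not> \<tau>' < 0\<close> by (intro mult_left_mono) auto
      moreover have "(1 - \<tau>') * (\<tau> * t) < (1 - \<tau>') * (- ln (a i))"
        using la assms(2) \<tau> by (intro mult_strict_left_mono) auto
      moreover have "\<tau>' * t < \<tau> * t" using assms(2) t by simp
      ultimately show ?thesis unfolding t' by (simp add: algebra_simps)
    qed
    then have "a i < exp (- (\<tau>' * t'))"
      using pos by (metis exp_less_cancel_iff exp_ln)
    with b' i t show "\<exists>n>T. \<exists>i\<in>I. a i < exp (- (\<tau>' * n)) \<and> b i - exp n * a i < exp (- (\<tau>' * n))"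
      by (intro exI[of _ t']) (auto simp: t'_def)
  qed
qed

section \<open>The exponents of the affine lattice as thresholds\<close>

lemma less_ext_ln: "ereal r < ext_ln x \<longleftrightarrow> ereal (exp r) < x"
proof (cases x)
  case (real y)
  show ?thesis
  proof (cases "0 < y")
    case True
    then show ?thesis using real by (simp add: ext_ln_def) (metis exp_less_cancel_iff exp_ln)
  next
    case False
    then have "\<not> exp r < y" by (meson exp_gt_zero less_trans)
    then show ?thesis using real False by (simp add: ext_ln_def)
  qed
qed (auto simp: ext_ln_def)

lemma less_ext_ln_\<alpha>\<^sub>1:
  "ereal r < ext_ln (\<alpha>\<^sub>1 x) \<longleftrightarrow> (\<exists>v\<in>lattice_of x. mixed_norm v < exp (- r))"
proof -
  have "ereal (exp r) < 1 / ereal N \<longleftrightarrow> N < exp (- r)" if "0 \<le> N" for N :: real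
  proof (cases "N = 0")
    case True
    then show ?thesis by (simp add: divide_ereal_def)
  next
    case False
    with that show ?thesis by (simp add: one_ereal_def exp_minus field_simps)
  qed
  moreover have "0 \<le> mixed_norm v" for v :: "real ^ ('a + 'b)"
    by (simp add: mixed_norm_def le_max_iff_disj)
  ultimately show ?thesis
    by (simp add: less_ext_ln \<alpha>\<^sub>1_def less_SUP_iff)
qed

lemma ereal_less_divide_real:
  assumes "0 < (c::real)"
  shows "ereal r < x / ereal c \<longleftrightarrow> ereal (r * c) < x"
  using assms by (cases x) (auto simp: field_simps)

lemma norm_matrix_vector_le:
  fixes B :: "real ^ 'm::finite ^ 'n::finite"
  shows "norm (B *v y) \<le> norm B * norm y"
proof -
  have "norm (B *v y) \<le> L2_set (\<lambda>i. norm (B $ i) * norm y) UNIV"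
    unfolding norm_vec_def[of "B *v y"]
    by (intro L2_set_mono) (auto simp: matrix_mult_dot Cauchy_Schwarz_ineq2)
  also have "\<dots> = norm B * norm y"
    by (simp add: L2_set_left_distrib norm_vec_def[of B])
  finally show ?thesis .
qed

text \<open>
  Since \<open>\<parallel>B y\<parallel> \<le> \<parallel>B\<parallel> \<parallel>y\<parallel>\<close>, with equality attained by rank one matrices, the vectors \<open>B y\<close> with
  \<open>\<parallel>B\<parallel> \<le> s\<close> fill the ball of radius \<open>s \<parallel>y\<parallel>\<close>. This is where \<open>y \<noteq> 0\<close> is needed.
\<close>

lemma exists_shear_iff:
  fixes y :: "real ^ 'm::finite" and q :: "real ^ 'n::finite"
  assumes "y \<noteq> 0" "0 \<le> s" "0 < r"
  shows "(\<exists>B :: real ^ 'm ^ 'n. norm B \<le> s \<and> norm (B *v y + q) < r) \<longleftrightarrow> norm q - s * norm y < r"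
proof
  assume "\<exists>B :: real ^ 'm ^ 'n. norm B \<le> s \<and> norm (B *v y + q) < r"
  then obtain B :: "real ^ 'm ^ 'n" where B: "norm B \<le> s" "norm (B *v y + q) < r" by blast
  have "norm q \<le> norm (B *v y + q) + norm (B *v y)"
    using norm_triangle_ineq4[of "B *v y + q" "B *v y"] by simp
  moreover have "norm (B *v y) \<le> s * norm y"
    using norm_matrix_vector_le[of B y] B(1) by (meson mult_right_mono norm_ge_zero order_trans)
  ultimately show "norm q - s * norm y < r" using B(2) by linarith
next
  assume less: "norm q - s * norm y < r"
  \<comment> \<open>The largest \<open>k \<le> 1\<close> for which the ball of radius \<open>s \<parallel>y\<parallel>\<close> contains \<open>k q\<close>; the matrix \<open>B\<close> below
    has rank one and sends \<open>y\<close> to \<open>- k q\<close>.\<close>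
  define k where "k = (if norm q \<le> s * norm y then 1 else s * norm y / norm q)"
  have k: "0 \<le> k" "k * norm q \<le> s * norm y" "norm ((1 - k) *\<^sub>R q) < r"
  proof -
    show "0 \<le> k" "k * norm q \<le> s * norm y" using assms by (auto simp: k_def)
    show "norm ((1 - k) *\<^sub>R q) < r"
    proof (cases "norm q \<le> s * norm y")
      case True
      then show ?thesis using assms by (simp add: k_def)
    next
      case False
      then have "0 < norm q" using assms(2) by (meson mult_nonneg_nonneg norm_ge_zero not_le order_trans)
      have "k \<le> 1" using False \<open>0 < norm q\<close> by (simp add: k_def)
      then have "norm ((1 - k) *\<^sub>R q) = norm q - k * norm q" by (simp add: left_diff_distrib del: scaleR_left_diff_distrib)
      also have "k * norm q = s * norm y" using False \<open>0 < norm q\<close> by (simp add: k_def)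
      finally show ?thesis using less by simp
    qed
  qed
  define B :: "real ^ 'm ^ 'n" where "B = (\<chi> i. (- (k * q $ i) / (norm y)\<^sup>2) *\<^sub>R y)"
  have "B *v y = - (k *\<^sub>R q)"
    using assms(1) by (simp add: vec_eq_iff B_def matrix_mult_dot power2_norm_eq_inner)
  then have "norm (B *v y + q) = norm ((1 - k) *\<^sub>R q)" by (simp add: algebra_simps)
  moreover have "norm B \<le> s"
  proof -
    have "norm B = L2_set (\<lambda>i. norm (q $ i) * (k / norm y)) UNIV"
      unfolding norm_vec_def[of B] using assms(1) k(1)
      by (intro L2_set_cong) (auto simp: B_def abs_mult power2_eq_square)
    also have "\<dots> = norm q * (k / norm y)"
      unfolding norm_vec_def[of q] using k(1) by (intro L2_set_left_distrib[symmetric]) simp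
    also have "\<dots> \<le> s" using k(2) assms(1) by (simp add: field_simps)
    finally show ?thesis .
  qed
  ultimately show "\<exists>B :: real ^ 'm ^ 'n. norm B \<le> s \<and> norm (B *v y + q) < r"
    using k(3) by auto
qed

lemma p1_block: "p1 (block_matrix P Q R S *v v) = P *v p1 v + Q *v p2 v"
  by (simp add: vec_eq_iff p1_def p2_def block_matrix_def matrix_vector_mult_def UNIV_sum_Plus)

lemma p2_block: "p2 (block_matrix P Q R S *v v) = R *v p1 v + S *v p2 v"
  by (simp add: vec_eq_iff p1_def p2_def block_matrix_def matrix_vector_mult_def UNIV_sum_Plus)

lemma p1_add: "p1 (u + v) = p1 u + p1 v" and p2_add: "p2 (u + v) = p2 u + p2 v"
  by (simp_all add: p1_def p2_def vec_eq_iff)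

lemma lattice_of_x_point:
  fixes A :: "real ^ ('n::finite) ^ ('m::finite)"
  shows "(\<exists>v\<in>lattice_of (x_point A v\<^sub>0). P (p1 v) (p2 v)) \<longleftrightarrow>
   (\<exists>u\<in>int_vecs. P (p1 (u + v\<^sub>0) - A *v p2 u) (p2 (u + v\<^sub>0)))"
proof -
  have "(- A) *v p2 u = - (A *v p2 u)" for u :: "real ^ ('m + 'n)"
    by (simp add: vec_eq_iff matrix_vector_mult_def sum_negf)
  then show ?thesis
    by (simp add: x_point_def lattice_of_affine_class p1_block p2_block p1_add p2_add algebra_simps)
qed

text \<open>
  The norms of the two projections of the lattice point attached to the integer vector \<open>u\<close>; the
  residual is also the error in the Diophantine condition.
\<close>

definition residual :: "real ^ 'n ^ 'm \<Rightarrow> real ^ ('m + 'n) \<Rightarrow> real ^ ('m::finite + 'n::finite) \<Rightarrow> real" where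
  "residual A v\<^sub>0 u = norm (A *v p2 u - p1 (u + v\<^sub>0))"

definition height :: "real ^ ('m + 'n) \<Rightarrow> real ^ ('m::finite + 'n::finite) \<Rightarrow> real" where
  "height v\<^sub>0 u = norm (p2 (u + v\<^sub>0))"

text \<open>The shift by \<open>n/d\<close> makes the exponents \<open>-\<tau>\<close> and \<open>1 - \<tau>\<close> come out, because \<open>n/d + m/d = 1\<close>.\<close>

lemma less_gamma_quotient_iff:
  fixes A :: "real ^ ('n::finite) ^ ('m::finite)"
  assumes "0 < t"
  shows "ereal (\<tau> - real CARD('n) / real (CARD('m) + CARD('n))) <
      ext_ln (\<alpha>\<^sub>1 (act (g_flow t) (x_point A v\<^sub>0))) / ereal t \<longleftrightarrow>
    (\<exists>u\<in>int_vecs. residual A v\<^sub>0 u < exp (- (\<tau> * t)) \<and> height v\<^sub>0 u < exp ((1 - \<tau>) * t))"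
proof -
  define m where "m = real CARD('m)"
  define n where "n = real CARD('n)"
  have mn: "m + n > 0" by (simp add: m_def n_def add_pos_pos)
  have sc: "(c *\<^sub>R mat 1) *v w = c *\<^sub>R w" for c and w :: "real ^ 'k::finite"
    by (simp add: scaleR_matrix_vector_assoc[symmetric])
  have g: "p1 (g_flow t *v v) = exp (n * t / (m + n)) *\<^sub>R p1 v"
    "p2 (g_flow t *v v) = exp (- m * t / (m + n)) *\<^sub>R p2 v" for v :: "real ^ ('m + 'n)"
    by (simp_all add: g_flow_def Let_def p1_block p2_block sc m_def n_def)
  have e: "exp x * N < exp z \<longleftrightarrow> N < exp (z - x)" for x z N :: real
    by (simp add: exp_diff field_simps)
  have e1: "- ((\<tau> - n / (m + n)) * t) - n * t / (m + n) = - (\<tau> * t)"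
    by (simp add: algebra_simps)
  have "n / (m + n) = 1 - m / (m + n)" using mn by (simp add: field_simps)
  then have "(n / (m + n)) * t = t - m * t / (m + n)" by (simp only:) (simp add: left_diff_distrib)
  then have e2: "m * t / (m + n) - (\<tau> - n / (m + n)) * t = (1 - \<tau>) * t"
    by (simp add: algebra_simps)
  have "ereal (\<tau> - n / (m + n)) < ext_ln (\<alpha>\<^sub>1 (act (g_flow t) (x_point A v\<^sub>0))) / ereal t
      \<longleftrightarrow> (\<exists>v\<in>lattice_of (x_point A v\<^sub>0). norm (p1 v) < exp (- (\<tau> * t)) \<and> norm (p2 v) < exp ((1 - \<tau>) * t))"
    using assms
    by (simp add: ereal_less_divide_real less_ext_ln_\<alpha>\<^sub>1 lattice_of_act mixed_norm_def g e e1 e2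
        del: mult_minus_left)
  also have "\<dots> \<longleftrightarrow> (\<exists>u\<in>int_vecs. residual A v\<^sub>0 u < exp (- (\<tau> * t)) \<and> height v\<^sub>0 u < exp ((1 - \<tau>) * t))"
    by (subst lattice_of_x_point) (simp add: residual_def height_def norm_minus_commute)
  finally show ?thesis by (simp add: m_def n_def)
qed

lemma less_beta_quotient_iff:
  fixes A :: "real ^ ('n::finite) ^ ('m::finite)"
  assumes "1 < s" and "\<forall>v\<in>int_vecs. A *v p2 v \<noteq> p1 (v + v\<^sub>0)"
  shows "ereal \<tau> < (SUP h\<in>h_ball s. ext_ln (\<alpha>\<^sub>1 (act h (x_point A v\<^sub>0)))) / ereal (ln s) \<longleftrightarrow>
    (\<exists>u\<in>int_vecs. residual A v\<^sub>0 u < exp (- (\<tau> * ln s)) \<and>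
       height v\<^sub>0 u - exp (ln s) * residual A v\<^sub>0 u < exp (- (\<tau> * ln s)))"
proof -
  define r where "r = exp (- (\<tau> * ln s))"
  have h: "p1 (h_mat B *v v) = p1 v" "p2 (h_mat B *v v) = B *v p1 v + p2 v"
    for B :: "real ^ 'm ^ 'n" and v
    by (simp_all add: h_mat_def p1_block p2_block)
  have "ereal \<tau> < (SUP h\<in>h_ball s. ext_ln (\<alpha>\<^sub>1 (act h (x_point A v\<^sub>0)))) / ereal (ln s) \<longleftrightarrow>
      (\<exists>B. norm B \<le> s \<and> (\<exists>v\<in>lattice_of (x_point A v\<^sub>0). norm (p1 v) < r \<and> norm (B *v p1 v + p2 v) < r))"
  proof -
    have "(\<exists>h\<in>h_ball s. R h) \<longleftrightarrow> (\<exists>B :: real ^ 'm ^ 'n. norm B \<le> s \<and> R (h_mat B))" for R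
      by (auto simp: h_ball_def)
    then show ?thesis
      using assms(1)
      by (simp add: ereal_less_divide_real less_SUP_iff less_ext_ln_\<alpha>\<^sub>1 lattice_of_act mixed_norm_def h r_def)
  qed
  also have "\<dots> \<longleftrightarrow> (\<exists>v\<in>lattice_of (x_point A v\<^sub>0). norm (p1 v) < r \<and>
      (\<exists>B :: real ^ 'm ^ 'n. norm B \<le> s \<and> norm (B *v p1 v + p2 v) < r))"
    by blast
  also have "\<dots> \<longleftrightarrow> (\<exists>u\<in>int_vecs. norm (p1 (u + v\<^sub>0) - A *v p2 u) < r \<and>
      (\<exists>B :: real ^ 'm ^ 'n. norm B \<le> s \<and> norm (B *v (p1 (u + v\<^sub>0) - A *v p2 u) + p2 (u + v\<^sub>0)) < r))"
    by (rule lattice_of_x_point)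
  also have "\<dots> \<longleftrightarrow> (\<exists>u\<in>int_vecs. residual A v\<^sub>0 u < r \<and> height v\<^sub>0 u - s * residual A v\<^sub>0 u < r)"
  proof (rule bex_cong[OF refl])
    fix u :: "real ^ ('m + 'n)" assume "u \<in> int_vecs"
    then have "p1 (u + v\<^sub>0) - A *v p2 u \<noteq> 0" using assms(2) by auto
    then show "(norm (p1 (u + v\<^sub>0) - A *v p2 u) < r \<and>
      (\<exists>B :: real ^ 'm ^ 'n. norm B \<le> s \<and> norm (B *v (p1 (u + v\<^sub>0) - A *v p2 u) + p2 (u + v\<^sub>0)) < r))
      \<longleftrightarrow> (residual A v\<^sub>0 u < r \<and> height v\<^sub>0 u - s * residual A v\<^sub>0 u < r)"
      using assms(1) by (subst exists_shear_iff) (auto simp: r_def residual_def height_def norm_minus_commute)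
  qed
  finally show ?thesis using assms(1) by (simp add: r_def)
qed

lemma threshold_gamma:
  fixes A :: "real ^ ('n::finite) ^ ('m::finite)"
  shows "is_threshold (flow_rate int_vecs (residual A v\<^sub>0) (height v\<^sub>0))
    (ereal (real CARD('n) / real (CARD('m) + CARD('n))) + gamma_exponent (x_point A v\<^sub>0))"
proof -
  let ?c = "real CARD('n) / real (CARD('m) + CARD('n))"
  define p where "p \<tau> t = (\<exists>u\<in>int_vecs. residual A v\<^sub>0 u < exp (- ((\<tau> + ?c) * t)) \<and>
      height v\<^sub>0 u < exp ((1 - (\<tau> + ?c)) * t))" for \<tau> t
  have "is_threshold (\<lambda>\<tau>. \<exists>\<^sub>F t in at_top. p \<tau> t) (gamma_exponent (x_point A v\<^sub>0))"
    unfolding gamma_exponent_def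
  proof (rule threshold_Limsup)
    fix \<tau> :: real
    show "\<forall>\<^sub>F t in at_top. (ereal \<tau> < ext_ln (\<alpha>\<^sub>1 (act (g_flow t) (x_point A v\<^sub>0))) / ereal t) = p \<tau> t"
      using eventually_gt_at_top[of 0]
    proof eventually_elim
      case (elim t)
      then show ?case using less_gamma_quotient_iff[of t "\<tau> + ?c" A v\<^sub>0] by (simp add: p_def)
    qed
  qed
  from threshold_shift[OF this, of ?c] show ?thesis
    by (simp add: p_def flow_rate_def[abs_def])
qed

lemma threshold_beta:
  fixes A :: "real ^ ('n::finite) ^ ('m::finite)"
  assumes "\<forall>v\<in>int_vecs. A *v p2 v \<noteq> p1 (v + v\<^sub>0)"
  shows "is_threshold (shear_rate int_vecs (residual A v\<^sub>0) (height v\<^sub>0)) (beta_exponent (x_point A v\<^sub>0))"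
proof -
  define p where "p \<tau> t = (\<exists>u\<in>int_vecs. residual A v\<^sub>0 u < exp (- (\<tau> * t)) \<and>
       height v\<^sub>0 u - exp t * residual A v\<^sub>0 u < exp (- (\<tau> * t)))" for \<tau> t
  have "is_threshold (\<lambda>\<tau>. \<exists>\<^sub>F s in at_top. p \<tau> (ln s)) (beta_exponent (x_point A v\<^sub>0))"
    unfolding beta_exponent_def
  proof (rule threshold_Limsup)
    fix \<tau> :: real
    show "\<forall>\<^sub>F s in at_top. (ereal \<tau> < (SUP h\<in>h_ball s. ext_ln (\<alpha>\<^sub>1 (act h (x_point A v\<^sub>0)))) / ereal (ln s))
        = p \<tau> (ln s)"
      using eventually_gt_at_top[of 1]
      by eventually_elim (simp only: less_beta_quotient_iff[OF _ assms] p_def)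
  qed
  then show ?thesis
    unfolding frequently_at_top_ln[of "p \<tau>" for \<tau>] unfolding p_def shear_rate_def .
qed

section \<open>The Diophantine exponent\<close>

lemma Ints_add_fraction_lower:
  fixes x z :: real
  assumes "z \<in> \<int>" "0 < x" "x < 1"
  shows "min x (1 - x) \<le> \<bar>z + x\<bar>"
proof -
  obtain k where k: "z = of_int k" using assms(1) by (auto elim: Ints_cases)
  show ?thesis
  proof (cases "k \<ge> 0")
    case True
    then show ?thesis using assms k by simp
  next
    case False
    then have "z \<le> -1" using k by simp
    then show ?thesis using assms by simp
  qed
qed

lemma height_lower:
  fixes v\<^sub>0 :: "real ^ ('m::finite + 'n::finite)"
  assumes "\<forall>i. 0 < v\<^sub>0 $ i \<and> v\<^sub>0 $ i < 1"
  obtains c where "0 < c" "\<And>u. u \<in> int_vecs \<Longrightarrow> c \<le> height v\<^sub>0 u"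
proof
  fix j :: 'n
  let ?x = "v\<^sub>0 $ Inr j"
  show "0 < min ?x (1 - ?x)" using assms by simp
  fix u :: "real ^ ('m + 'n)" assume "u \<in> int_vecs"
  then have "min ?x (1 - ?x) \<le> \<bar>u $ Inr j + ?x\<bar>"
    using assms by (intro Ints_add_fraction_lower) (auto simp: int_vecs_def)
  also have "\<dots> \<le> height v\<^sub>0 u"
    using component_le_norm_cart[of "p2 (u + v\<^sub>0)" j] by (simp add: height_def p2_def)
  finally show "min ?x (1 - ?x) \<le> height v\<^sub>0 u" .
qed

lemma residual_lower:
  fixes v\<^sub>0 :: "real ^ ('m::finite + 'n::finite)" and A :: "real ^ 'n ^ 'm"
  assumes "\<forall>i. 0 < v\<^sub>0 $ i \<and> v\<^sub>0 $ i < 1"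
  obtains c where "0 < c" "\<And>u. u \<in> int_vecs \<Longrightarrow> p2 u = 0 \<Longrightarrow> c \<le> residual A v\<^sub>0 u"
proof
  fix j :: 'm
  let ?x = "v\<^sub>0 $ Inl j"
  show "0 < min ?x (1 - ?x)" using assms by simp
  fix u :: "real ^ ('m + 'n)" assume u: "u \<in> int_vecs" "p2 u = 0"
  then have "min ?x (1 - ?x) \<le> \<bar>u $ Inl j + ?x\<bar>"
    using assms by (intro Ints_add_fraction_lower) (auto simp: int_vecs_def)
  also have "\<dots> \<le> residual A v\<^sub>0 u"
    using component_le_norm_cart[of "p1 (u + v\<^sub>0)" j] u(2) by (simp add: residual_def p1_def)
  finally show "min ?x (1 - ?x) \<le> residual A v\<^sub>0 u" .
qed

lemma height_bounds:
  "height v\<^sub>0 u \<le> norm (p2 u) + norm (p2 v\<^sub>0)" "norm (p2 u) \<le> height v\<^sub>0 u + norm (p2 v\<^sub>0)"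
  unfolding height_def p2_add
  using norm_triangle_ineq[of "p2 u" "p2 v\<^sub>0"] norm_triangle_ineq4[of "p2 u + p2 v\<^sub>0" "p2 v\<^sub>0"]
  by simp_all

lemma finite_int_vecs_bounded:
  "finite {v \<in> int_vecs. \<forall>i. \<bar>(v :: real ^ 'd::finite) $ i\<bar> \<le> R}"
proof -
  have "finite {x \<in> \<int>. \<bar>x\<bar> \<le> R}"
    by (rule finite_abs_int_segment)
  then have "finite (vec_lambda ` (UNIV \<rightarrow>\<^sub>E {x \<in> \<int>. \<bar>x\<bar> \<le> R}) :: (real ^ 'd) set)"
    by (intro finite_imageI finite_PiE) auto
  then show ?thesis
  proof (rule rev_finite_subset, safe)
    fix v :: "real ^ 'd"
    assume "v \<in> int_vecs" "\<forall>i. \<bar>v $ i\<bar> \<le> R"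
    then have "vec_nth v \<in> UNIV \<rightarrow>\<^sub>E {x \<in> \<int>. \<bar>x\<bar> \<le> R}" by (auto simp: int_vecs_def)
    then show "v \<in> vec_lambda ` (UNIV \<rightarrow>\<^sub>E {x \<in> \<int>. \<bar>x\<bar> \<le> R})"
      by (rule rev_image_eqI) (simp add: vec_nth_inverse)
  qed
qed

lemma finite_bounded_residual:
  "finite {v \<in> int_vecs. residual A v\<^sub>0 v \<le> K \<and> norm (p2 v) \<le> R}"
proof (rule finite_subset[OF _ finite_int_vecs_bounded[of "max R (K + norm A * R + norm (p1 v\<^sub>0))"]], safe)
  fix v :: "real ^ ('a + 'b)" and i
  assume v: "residual A v\<^sub>0 v \<le> K" "norm (p2 v) \<le> R"
  have "norm (A *v p2 v) \<le> norm A * R"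
    using norm_matrix_vector_le[of A "p2 v"] v(2) by (meson mult_left_mono norm_ge_zero order_trans)
  moreover have "norm (p1 v) \<le> norm (A *v p2 v) + norm (p1 v\<^sub>0) + residual A v\<^sub>0 v"
    unfolding residual_def p1_add by norm
  ultimately have 1: "norm (p1 v) \<le> K + norm A * R + norm (p1 v\<^sub>0)" using v(1) by linarith
  show "\<bar>v $ i\<bar> \<le> max R (K + norm A * R + norm (p1 v\<^sub>0))"
  proof (cases i)
    case (Inl j)
    then show ?thesis using 1 component_le_norm_cart[of "p1 v" j] by (simp add: p1_def)
  next
    case (Inr j)
    then show ?thesis using v(2) component_le_norm_cart[of "p2 v" j] by (simp add: p2_def)
  qed
qed

lemma norm_p2_ge_1:
  assumes "u \<in> int_vecs" "p2 u \<noteq> 0"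
  shows "1 \<le> norm (p2 u)"
proof -
  obtain j where j: "u $ Inr j \<noteq> 0" using assms(2) by (auto simp: vec_eq_iff p2_def)
  then have "1 \<le> \<bar>u $ Inr j\<bar>"
    using assms(1) by (auto simp: int_vecs_def intro!: Ints_nonzero_abs_ge1)
  also have "\<dots> \<le> norm (p2 u)" using component_le_norm_cart[of "p2 u" j] by (simp add: p2_def)
  finally show ?thesis .
qed

text \<open>The condition on \<open>\<nu>\<close> in the definition of the Diophantine exponent, without \<open>\<nu> > 0\<close>.\<close>

definition approximable :: "real ^ 'n ^ 'm \<Rightarrow> real ^ ('m::finite + 'n::finite) \<Rightarrow> real \<Rightarrow> bool" where
  "approximable A v\<^sub>0 \<nu> \<longleftrightarrow>
    infinite {v \<in> int_vecs. p2 v \<noteq> 0 \<and> residual A v\<^sub>0 v \<le> norm (p2 v) powr (- (\<nu> - 1))}"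

lemma dioph_exponent_eq: "dioph_exponent A v\<^sub>0 = Sup (ereal ` {\<nu>. \<nu> > 0 \<and> approximable A v\<^sub>0 \<nu>})"
  by (simp add: dioph_exponent_def approximable_def residual_def)

text \<open>
  For \<open>\<nu> < 1\<close> the allowed error grows with the height, so that rounding \<open>A q - p\<^sub>1(v\<^sub>0)\<close> to an integer
  vector is enough.
\<close>

lemma approximable_small:
  fixes A :: "real ^ ('n::finite) ^ ('m::finite)"
  assumes "\<nu> < 1"
  shows "approximable A v\<^sub>0 \<nu>"
proof -
  define q :: "nat \<Rightarrow> real ^ 'n" where "q k = (\<chi> j. real k)" for k
  define w :: "nat \<Rightarrow> real ^ ('m + 'n)" where
    "w k = (\<chi> i. case i of Inl a \<Rightarrow> of_int \<lfloor>(A *v q k) $ a - p1 v\<^sub>0 $ a\<rfloor> | Inr b \<Rightarrow> real k)" for k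
  have p2w: "p2 (w k) = q k" for k by (simp add: p2_def w_def q_def)
  have wint: "w k \<in> int_vecs" for k by (auto simp: int_vecs_def w_def split: sum.split)
  have res: "residual A v\<^sub>0 (w k) \<le> real CARD('m)" for k
  proof -
    have "norm (A *v q k - p1 (w k + v\<^sub>0)) \<le> (\<Sum>a\<in>UNIV. \<bar>(A *v q k - p1 (w k + v\<^sub>0)) $ a\<bar>)"
      by (rule norm_le_l1_cart)
    also have "\<dots> \<le> (\<Sum>a\<in>(UNIV::'m set). 1)"
    proof (rule sum_mono)
      fix a :: 'm
      have "(A *v q k - p1 (w k + v\<^sub>0)) $ a
          = ((A *v q k) $ a - p1 v\<^sub>0 $ a) - of_int \<lfloor>(A *v q k) $ a - p1 v\<^sub>0 $ a\<rfloor>"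
        by (simp add: p1_add) (simp add: p1_def w_def)
      then show "\<bar>(A *v q k - p1 (w k + v\<^sub>0)) $ a\<bar> \<le> 1" by linarith
    qed
    finally show ?thesis by (simp add: residual_def p2w)
  qed
  have normq: "real k \<le> norm (q k)" for k
    using component_le_norm_cart[of "q k"] by (simp add: q_def)
  have "\<forall>\<^sub>F k in sequentially. real CARD('m) < real k powr (1 - \<nu>)"
    using assms filterlim_real_sequentially
    by (intro eventually_compose_filterlim[OF eventually_less_powr]) auto
  then obtain N where N: "\<And>k. k \<ge> N \<Longrightarrow> real CARD('m) < real k powr (1 - \<nu>)"
    by (auto simp: eventually_sequentially)
  have "inj w" by (rule injI) (metis p2w q_def vec_lambda_beta of_nat_eq_iff)
  then have "infinite (w ` {max 1 N..})"
    using finite_imageD[of w "{max 1 N..}"] infinite_Ici inj_on_subset by blast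
  moreover have "w ` {max 1 N..} \<subseteq>
      {v \<in> int_vecs. p2 v \<noteq> 0 \<and> residual A v\<^sub>0 v \<le> norm (p2 v) powr (- (\<nu> - 1))}"
  proof (safe)
    fix k assume k: "max 1 N \<le> k"
    show "w k \<in> int_vecs" by (rule wint)
    show "False" if "p2 (w k) = 0" using that normq[of k] k by (simp add: p2w)
    have "real k powr (1 - \<nu>) \<le> norm (q k) powr (1 - \<nu>)"
      using normq[of k] assms by (intro powr_mono2) auto
    then show "residual A v\<^sub>0 (w k) \<le> norm (p2 (w k)) powr (- (\<nu> - 1))"
      using res[of k] N[of k] k by (simp add: p2w)
  qed
  ultimately show ?thesis
    unfolding approximable_def by (rule infinite_super[rotated])
qed

lemma dioph_exponent_ge_1: "1 \<le> dioph_exponent A v\<^sub>0"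
proof (rule ereal_le_by_reals)
  fix \<tau> assume "ereal \<tau> < 1"
  then have \<tau>: "\<tau> < 1" by (simp add: one_ereal_def)
  define \<nu> where "\<nu> = max \<tau> (1/2)"
  have "\<nu> > 0" "approximable A v\<^sub>0 \<nu>"
    using \<tau> by (auto simp: \<nu>_def intro!: approximable_small)
  then have "ereal \<nu> \<le> dioph_exponent A v\<^sub>0"
    unfolding dioph_exponent_eq by (intro Sup_upper) auto
  then show "ereal \<tau> \<le> dioph_exponent A v\<^sub>0"
    by (rule order_trans[rotated]) (simp add: \<nu>_def)
qed

text \<open>
  A good approximation with \<open>Q = \<parallel>p\<^sub>2(u)\<parallel>\<close> is used at the time \<open>t\<close> with \<open>e\<^bsup>(1-\<tau>)t\<^esup> = 2 Q\<close>. The factor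
  \<open>2\<close> absorbs the difference between \<open>Q\<close> and the height.
\<close>

lemma approximable_imp_flow:
  assumes "approximable A v\<^sub>0 \<nu>" "0 \<le> \<tau>" "\<tau> < 1" "1 / (1 - \<tau>) < \<nu>"
  shows "flow_rate int_vecs (residual A v\<^sub>0) (height v\<^sub>0) \<tau>"
  unfolding flow_rate_def frequently_at_top_iff
proof
  fix T :: real
  define \<sigma> where "\<sigma> = \<tau> / (1 - \<tau>)"
  have \<sigma>: "0 \<le> \<sigma>" "\<sigma> < \<nu> - 1" "\<sigma> = 1 / (1 - \<tau>) - 1"
    using assms by (auto simp: \<sigma>_def field_simps)
  have "\<forall>\<^sub>F Q::real in at_top. 2 powr \<sigma> < Q powr (\<nu> - 1 - \<sigma>)"
    using \<sigma> by (intro eventually_less_powr) simp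
  then obtain N where N: "\<And>Q. Q \<ge> N \<Longrightarrow> 2 powr \<sigma> < Q powr (\<nu> - 1 - \<sigma>)"
    by (auto simp: eventually_at_top_linorder)
  define R where "R = max (max 1 N) (max (norm (p2 v\<^sub>0)) (exp ((1 - \<tau>) * T)))"
  have R: "1 \<le> R" "N \<le> R" "norm (p2 v\<^sub>0) \<le> R" "exp ((1 - \<tau>) * T) \<le> R"
    unfolding R_def by linarith+
  obtain u where u: "u \<in> int_vecs" "p2 u \<noteq> 0"
    and ru: "residual A v\<^sub>0 u \<le> norm (p2 u) powr (- (\<nu> - 1))" and Ru: "R < norm (p2 u)"
  proof -
    let ?S = "{v \<in> int_vecs. p2 v \<noteq> 0 \<and> residual A v\<^sub>0 v \<le> norm (p2 v) powr (- (\<nu> - 1))}"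
    have "residual A v\<^sub>0 u \<le> 1" if "u \<in> int_vecs" "p2 u \<noteq> 0"
      "residual A v\<^sub>0 u \<le> norm (p2 u) powr (- (\<nu> - 1))" for u
    proof -
      have "norm (p2 u) powr (- (\<nu> - 1)) \<le> norm (p2 u) powr 0"
        using norm_p2_ge_1[OF that(1,2)] \<sigma> by (intro powr_mono) auto
      then show ?thesis using that by simp
    qed
    then have "{v \<in> ?S. norm (p2 v) \<le> R} \<subseteq> {v \<in> int_vecs. residual A v\<^sub>0 v \<le> 1 \<and> norm (p2 v) \<le> R}"
      by blast
    then have "finite {v \<in> ?S. norm (p2 v) \<le> R}"
      using finite_bounded_residual by (rule finite_subset)
    moreover have "infinite ?S" using assms(1) unfolding approximable_def .
    ultimately have "{v \<in> ?S. norm (p2 v) \<le> R} \<noteq> ?S" by metis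
    then obtain u where "u \<in> ?S" "\<not> norm (p2 u) \<le> R" by blast
    then show thesis by (intro that) auto
  qed
  define Q where "Q = norm (p2 u)"
  have Q: "R < Q" "0 < Q" using Ru R by (auto simp: Q_def)
  define t where "t = ln (2 * Q) / (1 - \<tau>)"
  have t1: "exp ((1 - \<tau>) * t) = 2 * Q" using Q assms(3) by (simp add: t_def)
  have "- (\<tau> * t) = (- \<sigma>) * ln (2 * Q)" by (simp add: t_def \<sigma>_def)
  then have t2: "exp (- (\<tau> * t)) = (2 * Q) powr (- \<sigma>)" using Q by (simp add: powr_def)
  have "exp ((1 - \<tau>) * T) < exp ((1 - \<tau>) * t)" using t1 R Q by simp
  then have "T < t" using assms(3) by simp
  moreover have "height v\<^sub>0 u < exp ((1 - \<tau>) * t)"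
    using height_bounds(1)[of v\<^sub>0 u] R Q unfolding t1 by (simp add: Q_def)
  moreover have "residual A v\<^sub>0 u < exp (- (\<tau> * t))"
  proof (rule le_less_trans)
    show "residual A v\<^sub>0 u \<le> Q powr (- (\<nu> - 1))" using ru by (simp add: Q_def)
    have "Q powr (- (\<nu> - 1)) * 2 powr \<sigma> < Q powr (- (\<nu> - 1)) * Q powr (\<nu> - 1 - \<sigma>)"
      using N[of Q] Q R by (intro mult_strict_left_mono) auto
    also have "\<dots> = Q powr (- \<sigma>)" by (simp add: powr_add[symmetric])
    finally show "Q powr (- (\<nu> - 1)) < exp (- (\<tau> * t))" unfolding t2 using Q
      by (simp add: powr_mult powr_minus field_simps)
  qed
  ultimately show "\<exists>t>T. \<exists>i\<in>int_vecs. residual A v\<^sub>0 i < exp (- (\<tau> * t)) \<and>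
      height v\<^sub>0 i < exp ((1 - \<tau>) * t)"
    using u(1) by blast
qed

text \<open>
  At large \<open>t\<close>, any \<open>u\<close> provided by \<open>flow_rate\<close> satisfies the condition for \<open>\<nu> = 1/(1-\<tau>')\<close>, and its
  residual is below \<open>e\<^bsup>-\<tau>t\<^esup>\<close>. Finitely many \<open>u\<close> cannot serve all \<open>t\<close>, since their residuals are
  positive.
\<close>

lemma flow_imp_approximable:
  fixes A :: "real ^ ('n::finite) ^ ('m::finite)"
  assumes flow: "flow_rate int_vecs (residual A v\<^sub>0) (height v\<^sub>0) \<tau>"
    and \<tau>': "0 < \<tau>'" "\<tau>' < \<tau>" "\<tau>' < 1"
    and v0: "\<forall>i. 0 < v\<^sub>0 $ i \<and> v\<^sub>0 $ i < 1"
    and irr: "\<forall>v\<in>int_vecs. A *v p2 v \<noteq> p1 (v + v\<^sub>0)"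
  shows "approximable A v\<^sub>0 (1 / (1 - \<tau>'))"
  unfolding approximable_def
proof
  define S where "S = {v \<in> int_vecs. p2 v \<noteq> 0 \<and>
    residual A v\<^sub>0 v \<le> norm (p2 v) powr (- (1 / (1 - \<tau>') - 1))}"
  assume "finite {v \<in> int_vecs. p2 v \<noteq> 0 \<and>
    residual A v\<^sub>0 v \<le> norm (p2 v) powr (- (1 / (1 - \<tau>') - 1))}"
  then have fin: "finite S" by (simp add: S_def)
  obtain c where c: "0 < c" "\<And>u. u \<in> int_vecs \<Longrightarrow> p2 u = 0 \<Longrightarrow> c \<le> residual A v\<^sub>0 u"
    using residual_lower[OF v0] by blast
  \<comment> \<open>Including \<open>c\<close> rules out \<open>p2 u = 0\<close>, and makes the minimum meaningful when \<open>S\<close> is empty.\<close>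
  define \<epsilon> where "\<epsilon> = Min (insert c (residual A v\<^sub>0 ` S))"
  have "0 < residual A v\<^sub>0 u" if "u \<in> S" for u
    using irr that by (auto simp: residual_def S_def)
  then have \<epsilon>: "0 < \<epsilon>" "\<epsilon> \<le> c" "\<And>u. u \<in> S \<Longrightarrow> \<epsilon> \<le> residual A v\<^sub>0 u"
    using fin c(1) by (auto simp: \<epsilon>_def)
  have \<tau>: "\<tau> \<le> 1"
    using height_lower[OF v0] flow_rate_le_1[OF flow] by metis
  have "\<forall>\<^sub>F t in at_top. 1 / \<epsilon> < exp (\<tau> * t)"
    "\<forall>\<^sub>F t in at_top. norm (p2 v\<^sub>0) + 1 < exp ((\<tau> - \<tau>') * t)"
    using \<tau>' by (intro eventually_less_exp; simp)+
  moreover have "\<forall>\<^sub>F t::real in at_top. 0 < t" by (rule eventually_gt_at_top)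
  ultimately have "\<forall>\<^sub>F t in at_top. 1 / \<epsilon> < exp (\<tau> * t) \<and>
      norm (p2 v\<^sub>0) + 1 < exp ((\<tau> - \<tau>') * t) \<and> 0 < t"
    by eventually_elim auto
  then obtain t where t: "1 / \<epsilon> < exp (\<tau> * t)" "norm (p2 v\<^sub>0) + 1 < exp ((\<tau> - \<tau>') * t)" "0 < t"
    and "\<exists>u\<in>int_vecs. residual A v\<^sub>0 u < exp (- (\<tau> * t)) \<and> height v\<^sub>0 u < exp ((1 - \<tau>) * t)"
    using frequently_ex[OF frequently_eventually_conj[OF flow[unfolded flow_rate_def]]] by blast
  then obtain u where u: "u \<in> int_vecs" and a: "residual A v\<^sub>0 u < exp (- (\<tau> * t))"
    and b: "height v\<^sub>0 u < exp ((1 - \<tau>) * t)" by blast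
  have "exp (- (\<tau> * t)) < \<epsilon>"
    using t(1) \<epsilon>(1) by (simp add: exp_minus field_simps)
  with a have less: "residual A v\<^sub>0 u < \<epsilon>" by simp
  have p2u: "p2 u \<noteq> 0"
    using less c(2)[OF u] \<epsilon>(2) by force
  define Q where "Q = norm (p2 u)"
  have Q: "0 < Q" using p2u by (simp add: Q_def)
  have "Q \<le> height v\<^sub>0 u + norm (p2 v\<^sub>0)"
    unfolding Q_def by (rule height_bounds)
  also have "\<dots> \<le> exp ((1 - \<tau>) * t) * 1 + exp ((1 - \<tau>) * t) * norm (p2 v\<^sub>0)"
    using b \<tau> t(3) mult_right_mono[of 1 "exp ((1 - \<tau>) * t)" "norm (p2 v\<^sub>0)"]
    by (intro add_mono) auto
  also have "\<dots> = exp ((1 - \<tau>) * t) * (norm (p2 v\<^sub>0) + 1)" by (simp add: algebra_simps)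
  also have "\<dots> \<le> exp ((1 - \<tau>) * t) * exp ((\<tau> - \<tau>') * t)"
    using t(2) by (intro mult_left_mono) auto
  also have "\<dots> = exp ((1 - \<tau>') * t)" by (simp add: exp_add[symmetric] algebra_simps)
  finally have "ln Q \<le> (1 - \<tau>') * t" using Q ln_mono[of Q "exp ((1 - \<tau>') * t)"] by simp
  then have "\<tau>' / (1 - \<tau>') * ln Q \<le> \<tau>' / (1 - \<tau>') * ((1 - \<tau>') * t)"
    using \<tau>' by (intro mult_left_mono) auto
  also have "\<dots> = \<tau>' * t" using \<tau>'(3) by simp
  also have "\<dots> \<le> \<tau> * t" using \<tau>' t by simp
  finally have "exp (- (\<tau> * t)) \<le> exp (- (\<tau>' / (1 - \<tau>') * ln Q))" by simp
  also have "\<dots> = Q powr (- (1 / (1 - \<tau>') - 1))"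
    using Q \<tau>'(3) by (simp add: powr_def field_simps)
  finally have "residual A v\<^sub>0 u \<le> Q powr (- (1 / (1 - \<tau>') - 1))" using a by simp
  then have "u \<in> S" using u p2u by (simp add: S_def Q_def)
  then show False using \<epsilon>(3)[of u] less by simp
qed

lemma threshold_dioph:
  fixes A :: "real ^ ('n::finite) ^ ('m::finite)"
  assumes v0: "\<forall>i. 0 < v\<^sub>0 $ i \<and> v\<^sub>0 $ i < 1"
    and irr: "\<forall>v\<in>int_vecs. A *v p2 v \<noteq> p1 (v + v\<^sub>0)"
  shows "is_threshold (flow_rate int_vecs (residual A v\<^sub>0) (height v\<^sub>0)) (1 - 1 / dioph_exponent A v\<^sub>0)"
  unfolding is_threshold_def
proof (intro conjI allI impI)
  let ?\<mu> = "dioph_exponent A v\<^sub>0"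
  have less_iff: "ereal \<tau> < 1 - 1 / ?\<mu> \<longleftrightarrow> ereal (1 / (1 - \<tau>)) < ?\<mu>" if "0 \<le> \<tau>" "\<tau> < 1" for \<tau>
    using that dioph_exponent_ge_1[of A v\<^sub>0]
    by (cases ?\<mu>) (auto simp: one_ereal_def field_simps)
  have le_iff: "ereal \<tau> \<le> 1 - 1 / ?\<mu> \<longleftrightarrow> ereal (1 / (1 - \<tau>)) \<le> ?\<mu>" if "\<tau> < 1" for \<tau>
    using that dioph_exponent_ge_1[of A v\<^sub>0]
    by (cases ?\<mu>) (auto simp: one_ereal_def field_simps)
  fix \<tau>
  {
    assume \<tau>: "ereal \<tau> < 1 - 1 / ?\<mu>"
    show "flow_rate int_vecs (residual A v\<^sub>0) (height v\<^sub>0) \<tau>"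
    proof (cases "\<tau> < 0")
      case True
      have "(0 :: real ^ ('m + 'n)) \<in> int_vecs" by (simp add: int_vecs_def)
      then show ?thesis using True by (intro flow_rate_neg) auto
    next
      case False
      have "1 - 1 / ?\<mu> \<le> ereal 1"
        using dioph_exponent_ge_1[of A v\<^sub>0] by (cases ?\<mu>) (auto simp: one_ereal_def)
      with \<tau> have "\<tau> < 1" by (metis less_le_trans less_ereal.simps(1))
      moreover obtain \<nu> where "approximable A v\<^sub>0 \<nu>" "1 / (1 - \<tau>) < \<nu>"
        using \<tau> less_iff[of \<tau>] False calculation unfolding dioph_exponent_eq less_Sup_iff by auto
      ultimately show ?thesis using False by (intro approximable_imp_flow) auto
    qed
  }
  {
    assume flow: "flow_rate int_vecs (residual A v\<^sub>0) (height v\<^sub>0) \<tau>"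
    have "\<tau> \<le> 1"
      using height_lower[OF v0] flow_rate_le_1[OF flow] by metis
    show "ereal \<tau> \<le> 1 - 1 / ?\<mu>"
    proof (rule ereal_le_by_reals)
      fix \<tau>' assume "ereal \<tau>' < ereal \<tau>"
      then have \<tau>': "\<tau>' < \<tau>" "\<tau>' < 1" using \<open>\<tau> \<le> 1\<close> by auto
      have "ereal (1 / (1 - \<tau>')) \<le> ?\<mu>"
      proof (cases "\<tau>' \<le> 0")
        case True
        then have "ereal (1 / (1 - \<tau>')) \<le> 1" by (simp add: one_ereal_def)
        then show ?thesis using dioph_exponent_ge_1 order_trans by blast
      next
        case False
        then show ?thesis
          unfolding dioph_exponent_eq
          using \<tau>' by (intro Sup_upper image_eqI[OF refl] CollectI conjI
              flow_imp_approximable[OF flow _ _ _ v0 irr]) auto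
      qed
      then show "ereal \<tau>' \<le> 1 - 1 / ?\<mu>" using le_iff \<tau>' by simp
    qed
  }
qed

theorem theorem2p4:
  fixes A :: "real ^ ('n::finite) ^ ('m::finite)" and v\<^sub>0 :: "real ^ ('m + 'n)"
  assumes "\<forall>i. 0 < v\<^sub>0 $ i \<and> v\<^sub>0 $ i < 1"
    and "\<forall>v\<in>int_vecs. A *v p2 v \<noteq> p1 (v + v\<^sub>0)"
  shows "beta_exponent (x_point A v\<^sub>0) =
           ereal (real CARD('n) / real (CARD('m) + CARD('n))) + gamma_exponent (x_point A v\<^sub>0)
       \<and> ereal (real CARD('n) / real (CARD('m) + CARD('n))) + gamma_exponent (x_point A v\<^sub>0) =
           1 - 1 / dioph_exponent A v\<^sub>0"
proof
  let ?a = "residual A v\<^sub>0" and ?b = "height v\<^sub>0"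
  obtain c where c: "0 < c" "\<And>u. u \<in> int_vecs \<Longrightarrow> c \<le> ?b u"
    using height_lower[OF assms(1)] by blast
  have a: "0 < ?a u" if "u \<in> int_vecs" for u
    using assms(2) that by (auto simp: residual_def)
  have "(0 :: real ^ ('m + 'n)) \<in> int_vecs" by (simp add: int_vecs_def)
  then have ne: "(int_vecs :: (real ^ ('m + 'n)) set) \<noteq> {}" by blast
  have "is_threshold (flow_rate int_vecs ?a ?b) (beta_exponent (x_point A v\<^sub>0))"
    using threshold_beta[OF assms(2)]
  proof (rule threshold_transfer)
    show "flow_rate int_vecs ?a ?b \<tau>'" if "shear_rate int_vecs ?a ?b \<tau>" "\<tau>' < \<tau>" for \<tau> \<tau>'
      using that by (rule shear_imp_flow)
    show "shear_rate int_vecs ?a ?b \<tau>'" if "flow_rate int_vecs ?a ?b \<tau>" "\<tau>' < \<tau>" for \<tau> \<tau>'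
      using that ne a c by (rule flow_imp_shear)
  qed
  then show "beta_exponent (x_point A v\<^sub>0) =
      ereal (real CARD('n) / real (CARD('m) + CARD('n))) + gamma_exponent (x_point A v\<^sub>0)"
    using threshold_gamma by (rule threshold_unique)
  show "ereal (real CARD('n) / real (CARD('m) + CARD('n))) + gamma_exponent (x_point A v\<^sub>0) =
      1 - 1 / dioph_exponent A v\<^sub>0"
    using threshold_gamma threshold_dioph[OF assms] by (rule threshold_unique)
qed

end
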